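(* Let $A\in\mathbb C^{n\times n}$, let $f$ be a scalar function such that $f(A)$ is defined, and assume that $f(A)$ has exponential decay, i.e., there are constants $C>0$ and $0\le q<1$ such that $$|[f(A)]_{ij}|\le C\,q^{\mathrm d(i,j)}\qquad\text{for all } i,j\in\{1,\dots,n\}.$$ Let $d$ be a positive integer, let $V_1,\dots,V_m$ be the color classes of a distance-$2d$ coloring of the undirected graph $|G(A)|$, and let $v_\ell=\sum_{i\in V_\ell}e_i$, $\ell=1,\dots,m$. Define $f(A)^{[d]}\in\mathbb C^{n\times n}$ by $$[f(A)^{[d]}]_{ij}=\begin{cases}[f(A)v_\ell]_i \text{ for } j\in V_\ell & \text{if } \bar{\mathrm d}(i,j)\le d,\\ 0 & \text{if } \bar{\mathrm d}(i,j)>d.\end{cases}$$ Then with $\varepsilon=Cq^d$ the following holds for all $i,j\in\{1,\dots,n\}$: $$\big|[f(A)]_{ij}-[f(A)^{[d]}]_{ij}\big|\le\begin{cases}(|V_\ell|-1)\,\varepsilon \text{ for } j\in V_\ell & \text{if } \bar{\mathrm d}(i,j)\le d,\\ \varepsilon & \text{if } \bar{\mathrm d}(i,j)>d.\end{cases}$$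
   Context: The directed graph $G(A)$ of $A$ has vertices $V=\{1,\dots,n\}$ and edges $\{(i,j): a_{ij}\ne0,\ i\ne j\}$. $|G(A)|$ is the undirected graph obtained by removing the direction of the edges. $\mathrm d(i,j)$ is the geodesic distance (length of a shortest path from $i$ to $j$) in $G(A)$ and $\bar{\mathrm d}(i,j)$ the geodesic distance in $|G(A)|$; both are $\infty$ if there is no path, and $q^\infty:=0$. A distance-$k$ coloring of a graph is a mapping $\mathrm{col}:V\to\{1,\dots,m\}$ such that $\mathrm{col}(i)\ne\mathrm{col}(j)$ whenever $i\neq j$ and the distance from $i$ to $j$ is at most $k$; its color classes are $V_\ell=\{i:\mathrm{col}(i)=\ell\}$ (they partition $V$). $e_i$ is the $i$th canonical unit vector. The matrix function $f(A)$ is the usual one: $f(A)=p(A)$, where $p$ is a polynomial interpolating $f$ on the spectrum of $A$ in the Hermite sense (with the required derivatives of $f$ assumed to exist). *)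

theory Defs
  imports
    "HOL-Analysis.Derivative"
    "HOL-Library.Extended_Nat"
    "Jordan_Normal_Form.Spectral_Radius"
    "Graph_Theory.Graph_Theory"
begin

unbundle no vec_syntax

text \<open>Matrices are those of \<^theory>\<open>Jordan_Normal_Form.Matrix\<close>, so rows, columns and vertices are
  numbered \<open>0, \<dots>, n - 1\<close>.\<close>

subsection \<open>Matrix functions\<close>

text \<open>The index of an eigenvalue is the size of its largest Jordan block, i.e. its multiplicity as a
  root of the minimal polynomial.\<close>

definition eigenvalue_index :: "complex mat \<Rightarrow> complex \<Rightarrow> nat" where
  "eigenvalue_index A ev = Max {k. \<exists>n_as. jordan_nf A n_as \<and> (k, ev) \<in> set n_as}"

text \<open>Existence of the complex derivatives of orders \<open>0, \<dots>, k\<close> of \<open>f\<close> at \<open>z\<close>. The derivative of order \<open>k\<close>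
  has to exist near \<open>z\<close> before that of order \<open>k + 1\<close> makes sense at \<open>z\<close>; this has to be required
  explicitly since \<^const>\<open>deriv\<close> is total. Nothing is required for \<open>k = 0\<close>, so \<open>f\<close> may be
  an arbitrary function near an eigenvalue of index 1.\<close>

primrec has_derivs_upto :: "nat \<Rightarrow> (complex \<Rightarrow> complex) \<Rightarrow> complex \<Rightarrow> bool" where
  "has_derivs_upto 0 f z \<longleftrightarrow> True"
| "has_derivs_upto (Suc k) f z \<longleftrightarrow>
     (\<forall>\<^sub>F w in nhds z. has_derivs_upto k f w) \<and> (deriv ^^ k) f field_differentiable (at z)"

definition defined_on_spectrum :: "(complex \<Rightarrow> complex) \<Rightarrow> complex mat \<Rightarrow> bool" where
  "defined_on_spectrum f A \<longleftrightarrow>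
     (\<forall>ev \<in> spectrum A. has_derivs_upto (eigenvalue_index A ev - 1) f ev)"

definition hermite_interpolates :: "complex poly \<Rightarrow> (complex \<Rightarrow> complex) \<Rightarrow> complex mat \<Rightarrow> bool" where
  "hermite_interpolates p f A \<longleftrightarrow>
     (\<forall>ev \<in> spectrum A. \<forall>j < eigenvalue_index A ev.
        poly ((pderiv ^^ j) p) ev = (deriv ^^ j) f ev)"

definition poly_mat :: "complex poly \<Rightarrow> complex mat \<Rightarrow> complex mat" where
  "poly_mat p A = finsum (module_mat TYPE(complex) (dim_row A) (dim_row A))
     (\<lambda>k. Polynomial.coeff p k \<cdot>\<^sub>m (A ^\<^sub>m k)) {..degree p}"

text \<open>All interpolating polynomials have the same value at \<open>A\<close>.\<close>

definition matfun :: "(complex \<Rightarrow> complex) \<Rightarrow> complex mat \<Rightarrow> complex mat" where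
  "matfun f A = poly_mat (SOME p. hermite_interpolates p f A) A"

subsection \<open>Graphs, distances and colorings\<close>

definition mat_graph :: "complex mat \<Rightarrow> nat pair_pre_digraph" where
  "mat_graph A = \<lparr> pverts = {0..<dim_row A},
     parcs = {(i, j). i < dim_row A \<and> j < dim_row A \<and> A $$ (i, j) \<noteq> 0 \<and> i \<noteq> j} \<rparr>"

text \<open>An undirected graph is represented by the digraph having both orientations of each edge.\<close>

definition mat_ugraph :: "complex mat \<Rightarrow> nat pair_pre_digraph" where
  "mat_ugraph A = mk_symmetric (with_proj (mat_graph A))"

text \<open>The infimum of the empty set is \<open>\<infinity>\<close>.\<close>

definition geodist :: "nat pair_pre_digraph \<Rightarrow> nat \<Rightarrow> nat \<Rightarrow> enat" where
  "geodist G u v = (INF p \<in> {p. pre_digraph.apath (with_proj G) u p v}. enat (length p))"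

definition power_enat :: "real \<Rightarrow> enat \<Rightarrow> real" where
  "power_enat q k = (case k of enat a \<Rightarrow> q ^ a | \<infinity> \<Rightarrow> 0)"

definition distance_coloring :: "nat \<Rightarrow> nat pair_pre_digraph \<Rightarrow> nat \<Rightarrow> (nat \<Rightarrow> nat) \<Rightarrow> bool" where
  "distance_coloring k G m clr \<longleftrightarrow>
     clr ` pverts G \<subseteq> {1..m} \<and>
     (\<forall>i \<in> pverts G. \<forall>j \<in> pverts G. i \<noteq> j \<and> geodist G i j \<le> enat k \<longrightarrow> clr i \<noteq> clr j)"

definition color_class :: "nat pair_pre_digraph \<Rightarrow> (nat \<Rightarrow> nat) \<Rightarrow> nat \<Rightarrow> nat set" where
  "color_class G clr l = {i \<in> pverts G. clr i = l}"

subsection \<open>The approximation obtained by probing\<close>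

definition probing_vec :: "nat \<Rightarrow> nat set \<Rightarrow> complex vec" where
  "probing_vec n V = finsum_vec TYPE(complex) n (unit_vec n) V"

text \<open>The index \<open>l\<close> of the color class containing \<open>j\<close> is \<open>clr j\<close>.\<close>

definition probing_approx ::
    "(complex \<Rightarrow> complex) \<Rightarrow> complex mat \<Rightarrow> (nat \<Rightarrow> nat) \<Rightarrow> nat \<Rightarrow> complex mat" where
  "probing_approx f A clr d = mat (dim_row A) (dim_row A) (\<lambda>(i, j).
     if geodist (mat_ugraph A) i j \<le> enat d
     then (matfun f A *\<^sub>v probing_vec (dim_row A) (color_class (mat_ugraph A) clr (clr j))) $ i
     else 0)"

end

theory Submission
  imports Defs
begin

text \<open>
  The \<open>(i, j)\<close> entry of the error is minus the sum of \<open>[f(A)]\<^sub>i\<^sub>k\<close> over the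
  \<open>k \<noteq> j\<close> sharing the color of \<open>j\<close> if \<open>j\<close> is within undirected distance \<open>d\<close> of \<open>i\<close>, and
  \<open>[f(A)]\<^sub>i\<^sub>j\<close> otherwise. In the first case each such \<open>k\<close> is farther than \<open>d\<close> from \<open>i\<close>, since
  otherwise \<open>j\<close> and \<open>k\<close> would be within distance \<open>2d\<close> of each other. Directed distances are at
  least as large as undirected ones, so every entry involved is at most \<open>C q\<^sup>d\<close> in modulus.
\<close>

text \<open>Bridges walks and \<open>geodist\<close>, whose infimum ranges over
  \<open>apath\<close>s only: \<open>awalk_to_apath\<close> cuts the cycles out of a walk and keeps
  only arcs of it.\<close>

lemma geodist_le_length:
  assumes "pair_wf_digraph G" and "pre_digraph.awalk (with_proj G) u p v"
  shows "geodist G u v \<le> enat (length p)"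
proof -
  interpret pair_wf_digraph G by fact
  let ?r = "awalk_to_apath p"
  have r: "apath u ?r v"
    using assms(2) by (rule apath_awalk_to_apath)
  \<comment> \<open>A path without repeated vertices repeats no arc, so its length is the size of
    its arc set, which can be compared with that of \<open>p\<close>.\<close>
  then have "distinct ?r"
    unfolding apath_def by (blast intro: distinct_verts_imp_distinct)
  then have "length ?r = card (set ?r)"
    by (simp add: distinct_card)
  also have "\<dots> \<le> card (set p)"
    using awalk_to_apath_subset[OF assms(2)] by (simp add: card_mono)
  also have "\<dots> \<le> length p"
    by (rule card_length)
  finally have "enat (length ?r) \<le> enat (length p)"
    by simp
  moreover have "geodist G u v \<le> enat (length ?r)"
    unfolding geodist_def using r by (intro INF_lower) simp
  ultimately show ?thesis
    by (rule order_trans[rotated])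
qed

lemma geodist_le_enatE:
  assumes "geodist G u v \<le> enat k"
  obtains p where "pre_digraph.awalk (with_proj G) u p v" and "length p \<le> k"
proof -
  \<comment> \<open>The strict bound makes \<open>INF_less_iff\<close> supply a witness, so
    attainment of the infimum need not be argued separately.\<close>
  have "geodist G u v < enat (Suc k)"
    using assms by (rule order_le_less_trans) simp
  then obtain p where "pre_digraph.apath (with_proj G) u p v" and "length p < Suc k"
    unfolding geodist_def by (auto simp: INF_less_iff)
  then show thesis
    using that by (auto simp: pre_digraph.apath_def)
qed

text \<open>The concatenation of two shortest paths may revisit vertices, but it is a walk, and
  walks bound \<open>geodist\<close>.\<close>

lemma geodist_triangle_le:
  assumes G: "pair_wf_digraph G"
    and uv: "geodist G u v \<le> enat k" and vw: "geodist G v w \<le> enat l"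
  shows "geodist G u w \<le> enat (k + l)"
proof -
  interpret pair_wf_digraph G by fact
  from uv obtain p where p: "awalk u p v" "length p \<le> k"
    by (rule geodist_le_enatE)
  from vw obtain r where r: "awalk v r w" "length r \<le> l"
    by (rule geodist_le_enatE)
  have "awalk u (p @ r) w"
    using p(1) r(1) by (rule awalk_appendI)
  then have "geodist G u w \<le> enat (length (p @ r))"
    by (rule geodist_le_length[OF G])
  also have "\<dots> \<le> enat (k + l)"
    using p(2) r(2) by simp
  finally show ?thesis .
qed

lemma length_rev_path: "length (rev_path p) = length p"
  by (induct p) simp_all

lemma geodist_sym_le:
  assumes G: "pair_sym_digraph G" and uv: "geodist G u v \<le> enat k"
  shows "geodist G v u \<le> enat k"
proof -
  interpret pair_sym_digraph G by fact
  from uv obtain p where p: "awalk u p v" "length p \<le> k"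
    by (rule geodist_le_enatE)
  have "awalk v (rev_path p) u"
    using p(1) by simp
  then have "geodist G v u \<le> enat (length (rev_path p))"
    by (rule geodist_le_length[OF pair_wf_digraph_axioms])
  also have "\<dots> \<le> enat k"
    using p(2) by (simp add: length_rev_path)
  finally show ?thesis .
qed

text \<open>Arcs are pairs, so the vertices visited by an arc list are the same in \<open>G\<close>
  and \<open>H\<close>. Every path of \<open>G\<close> is thus one of \<open>H\<close>, and the
  infimum for \<open>H\<close> ranges over a larger set.\<close>

lemma geodist_antimono:
  assumes "pverts G \<subseteq> pverts H" and "parcs G \<subseteq> parcs H"
  shows "geodist H u v \<le> geodist G u v"
  unfolding geodist_def using assms
  by (intro INF_superset_mono)
    (auto simp: pre_digraph.apath_def pre_digraph.awalk_def cas_with_proj_eq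
      awalk_verts_with_proj_eq)

lemma pair_wf_digraph_mat_graph: "pair_wf_digraph (mat_graph A)"
  by unfold_locales (auto simp: mat_graph_def)

lemma pair_sym_digraph_mat_ugraph: "pair_sym_digraph (mat_ugraph A)"
proof -
  interpret pair_wf_digraph "mat_graph A"
    by (rule pair_wf_digraph_mat_graph)
  interpret U: pair_wf_digraph "mat_ugraph A"
    unfolding mat_ugraph_def by (rule wellformed_mk_symmetric)
  show ?thesis
    by unfold_locales (simp add: mat_ugraph_def symmetric_mk_symmetric)
qed

lemma pverts_mat_ugraph [simp]: "pverts (mat_ugraph A) = {0..<dim_row A}"
  by (simp add: mat_ugraph_def mat_graph_def)

lemma geodist_mat_ugraph_le: "geodist (mat_ugraph A) i j \<le> geodist (mat_graph A) i j"
proof (rule geodist_antimono)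
  show "pverts (mat_graph A) \<subseteq> pverts (mat_ugraph A)"
    by (simp add: mat_graph_def)
  show "parcs (mat_graph A) \<subseteq> parcs (mat_ugraph A)"
    by (auto simp: mat_ugraph_def parcs_mk_symmetric)
qed

lemma distance_coloring_same_color_far:
  assumes G: "pair_sym_digraph G" and clr: "distance_coloring (2 * d) G m clr"
    and V: "j \<in> pverts G" "k \<in> pverts G" and "k \<noteq> j" "clr k = clr j"
    and ij: "geodist G i j \<le> enat d"
  shows "enat d < geodist G i k"
proof (rule ccontr)
  interpret pair_sym_digraph G by fact
  assume "\<not> enat d < geodist G i k"
  \<comment> \<open>Symmetry of \<open>G\<close> turns the distance from \<open>i\<close> to
    \<open>k\<close> around, so that the walk from \<open>k\<close> to \<open>j\<close> can pass
    through \<open>i\<close>.\<close>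
  then have "geodist G k i \<le> enat d"
    by (simp add: geodist_sym_le[OF G])
  then have "geodist G k j \<le> enat (d + d)"
    using ij by (rule geodist_triangle_le[OF pair_wf_digraph_axioms])
  then have "geodist G k j \<le> enat (2 * d)"
    by (simp add: mult_2)
  with clr V \<open>k \<noteq> j\<close> \<open>clr k = clr j\<close> show False
    by (auto simp: distance_coloring_def)
qed

text \<open>Powers of \<open>q\<close> decrease on the unit interval; at \<infinity> the left side
  is 0, which is below \<open>q ^ d\<close> because \<open>q\<close> is nonnegative.\<close>

lemma power_enat_le_power:
  assumes "0 \<le> q" "q \<le> 1" "enat d \<le> k"
  shows "power_enat q k \<le> q ^ d"
  using assms by (cases k) (auto simp: power_enat_def intro: power_decreasing)

lemma matfun_carrier:
  assumes "A \<in> carrier_mat n n"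
  shows "matfun f A \<in> carrier_mat n n"
proof -
  interpret abelian_group "module_mat TYPE(complex) n n"
    by (rule abelian_group_mat)
  \<comment> \<open>Closure is shown for an arbitrary \<open>p\<close>, which covers the polynomial
    picked by \<open>SOME\<close>.\<close>
  have "finsum (module_mat TYPE(complex) n n) (\<lambda>k. Polynomial.coeff p k \<cdot>\<^sub>m (A ^\<^sub>m k)) {..degree p}
      \<in> carrier (module_mat TYPE(complex) n n)" for p
    by (rule finsum_closed) (use assms in \<open>auto simp: module_mat_simps\<close>)
  then show ?thesis
    using assms by (simp add: matfun_def poly_mat_def module_mat_simps)
qed

text \<open>The probing vector is the indicator vector of \<open>V\<close>, so the product adds up
  the columns of \<open>B\<close> indexed by \<open>V\<close>.\<close>

lemma mult_mat_probing_vec: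
  assumes B: "B \<in> carrier_mat n n" and V: "V \<subseteq> {0..<n}" and i: "i < n"
  shows "(B *\<^sub>v probing_vec n V) $ i = (\<Sum>k\<in>V. B $$ (i, k))"
proof -
  have fin: "finite V"
    using V by (rule finite_subset) simp
  have dim: "dim_vec (probing_vec n V) = n"
    unfolding probing_vec_def
    by (rule carrier_vecD, rule finsum_vec_closed) auto
  have entry: "probing_vec n V $ k = (if k \<in> V then 1 else 0)" if "k < n" for k
  proof -
    have "probing_vec n V $ k = (\<Sum>l\<in>V. unit_vec n l $ k)"
      unfolding probing_vec_def using fin that by (intro index_finsum_vec) auto
    also have "\<dots> = (\<Sum>l\<in>V. if l = k then 1 else 0)"
      using V that by (intro sum.cong) (auto simp: unit_vec_def)
    finally show ?thesis
      using fin by simp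
  qed
  have "(B *\<^sub>v probing_vec n V) $ i = (\<Sum>k\<in>{0..<n}. B $$ (i, k) * probing_vec n V $ k)"
    using B i dim by (simp add: scalar_prod_def)
  also have "\<dots> = (\<Sum>k\<in>{0..<n}. if k \<in> V then B $$ (i, k) else 0)"
    by (rule sum.cong) (auto simp: entry)
  also have "\<dots> = (\<Sum>k\<in>V. B $$ (i, k))"
    using V by (simp add: sum.If_cases Int_absorb1)
  finally show ?thesis .
qed

theorem proposition3p5:
  fixes A :: "complex mat" and f :: "complex \<Rightarrow> complex" and C q :: real
    and n m d :: nat and clr :: "nat \<Rightarrow> nat"
  assumes "A \<in> carrier_mat n n"
    and "defined_on_spectrum f A"
    and "C > 0" and "0 \<le> q" and "q < 1"
    and "\<forall>i<n. \<forall>j<n. cmod (matfun f A $$ (i, j)) \<le> C * power_enat q (geodist (mat_graph A) i j)"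
    and "d > 0"
    and "distance_coloring (2 * d) (mat_ugraph A) m clr"
  shows "\<forall>i<n. \<forall>j<n.
    cmod (matfun f A $$ (i, j) - probing_approx f A clr d $$ (i, j)) \<le>
      (let \<epsilon> = C * q ^ d in
       if geodist (mat_ugraph A) i j \<le> enat d
       then (real (card (color_class (mat_ugraph A) clr (clr j))) - 1) * \<epsilon>
       else \<epsilon>)"
proof (intro allI impI)
  fix i j
  assume i: "i < n" and j: "j < n"
  let ?F = "matfun f A" and ?U = "mat_ugraph A"
  let ?V = "color_class ?U clr (clr j)"
  have n: "dim_row A = n"
    using assms(1) by simp
  have far: "cmod (?F $$ (i, k)) \<le> C * q ^ d" if "k < n" "enat d < geodist ?U i k" for k
  proof -
    have "enat d \<le> geodist (mat_graph A) i k"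
      using that(2) geodist_mat_ugraph_le[of A i k] by simp
    then have "power_enat q (geodist (mat_graph A) i k) \<le> q ^ d"
      using assms(4,5) by (intro power_enat_le_power) auto
    then have "C * power_enat q (geodist (mat_graph A) i k) \<le> C * q ^ d"
      using assms(3) by simp
    with assms(6) i that(1) show ?thesis
      by (meson order_trans)
  qed
  show "cmod (?F $$ (i, j) - probing_approx f A clr d $$ (i, j)) \<le>
      (let \<epsilon> = C * q ^ d in
       if geodist ?U i j \<le> enat d then (real (card ?V) - 1) * \<epsilon> else \<epsilon>)"
  proof (cases "geodist ?U i j \<le> enat d")
    case True
    have V: "?V \<subseteq> {0..<n}"
      using n by (auto simp: color_class_def)
    then have fin: "finite ?V"
      by (rule finite_subset) simp
    have jV: "j \<in> ?V"
      using j n by (simp add: color_class_def)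
    have "probing_approx f A clr d $$ (i, j) = (?F *\<^sub>v probing_vec n ?V) $ i"
      using True i j n by (simp add: probing_approx_def)
    also have "\<dots> = (\<Sum>k\<in>?V. ?F $$ (i, k))"
      using matfun_carrier[OF assms(1)] V i by (rule mult_mat_probing_vec)
    \<comment> \<open>The wanted entry is split off; it cancels in the error, and the remaining sum
      is what aliasing within the color class contributes.\<close>
    also have "\<dots> = ?F $$ (i, j) + (\<Sum>k\<in>?V - {j}. ?F $$ (i, k))"
      using fin jV by (rule sum.remove)
    finally have "cmod (?F $$ (i, j) - probing_approx f A clr d $$ (i, j))
        = cmod (\<Sum>k\<in>?V - {j}. ?F $$ (i, k))"
      by (simp add: norm_minus_commute)
    also have "\<dots> \<le> real (card (?V - {j})) * (C * q ^ d)"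
    proof (rule sum_norm_bound)
      fix k
      assume "k \<in> ?V - {j}"
      then have k: "k < n" "k \<noteq> j" "clr k = clr j"
        using n by (auto simp: color_class_def)
      have "enat d < geodist ?U i k"
        by (rule distance_coloring_same_color_far[OF pair_sym_digraph_mat_ugraph assms(8) _ _ k(2,3) True])
          (use j k n in auto)
      with k(1) show "cmod (?F $$ (i, k)) \<le> C * q ^ d"
        by (rule far)
    qed
    \<comment> \<open>Since \<open>j\<close> lies in its own class, the cardinality is at least 1
      and the truncated subtraction on naturals agrees with the real one.\<close>
    also have "real (card (?V - {j})) = real (card ?V) - 1"
      using fin jV card_gt_0_iff[of ?V] by (auto simp: card_Diff_singleton of_nat_diff)
    finally show ?thesis
      using True by (simp add: Let_def)
  next
    case False
    then show ?thesis
      using far[OF j] i j n by (simp add: probing_approx_def Let_def)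
  qed
qed

end
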